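(* There exist a field $F$ of characteristic not $2$, a quaternion division algebra $Q$ over $F$, and a left ideal $I$ of $R_Q=Q[x,y]$ such that $\mathcal{V}_c(I)=\emptyset$ but $\mathcal{V}(I)\neq\emptyset$. In particular, there is a polynomial $f\in R_Q$ which vanishes on $\mathcal{V}_c(I)$ but does not vanish on $\mathcal{V}(I)$.
   Context: For a field $F$ of characteristic not $2$, a quaternion algebra over $F$ is an algebra $(\alpha,\beta)_F=F\langle i,j \mid i^2=\alpha,\ j^2=\beta,\ ji=-ij\rangle$ with $\alpha,\beta\in F^*$. For a division ring $D$, $D[x,y]$ is the ring of polynomials in two central variables: the variables commute with each other and with all coefficients. For $f=\sum a_{r,s}x^ry^s\in D[x,y]$ (coefficients on the left) and $(a,b)\in D^2$, define $f(a,b)=\sum a_{r,s}a^rb^s$ (products in this order). For $I\subseteq D[x,y]$, $\mathcal{V}(I)=\{(a,b)\in D^2 : f(a,b)=0\text{ for all }f\in I\}$, $D^2_c=\{(a,b)\in D^2 : ab=ba\}$, and $\mathcal{V}_c(I)=\mathcal{V}(I)\cap D^2_c$. *)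

theory Defs
  imports Complex_Main "HOL-Algebra.UnivPoly" "HOL-Algebra.QuotRing"
begin

definition division_ring :: "('a, 'm) ring_scheme \<Rightarrow> bool" where
  "division_ring D \<longleftrightarrow> ring D \<and> \<one>\<^bsub>D\<^esub> \<noteq> \<zero>\<^bsub>D\<^esub> \<and> Units D = carrier D - {\<zero>\<^bsub>D\<^esub>}"

definition left_ideal :: "'a set \<Rightarrow> ('a, 'm) ring_scheme \<Rightarrow> bool" where
  "left_ideal I R \<longleftrightarrow>
     additive_subgroup I R \<and> (\<forall>g\<in>carrier R. \<forall>f\<in>I. g \<otimes>\<^bsub>R\<^esub> f \<in> I)"


section \<open>Quaternion algebras\<close>

text \<open>
  The free associative algebra over \<open>F\<close> on the letters of type \<open>'v\<close>: an element is the
  finitely supported function that assigns to each word its coefficient.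
\<close>

definition free_algebra :: "('a, 'm) ring_scheme \<Rightarrow> ('v list \<Rightarrow> 'a) ring" where
  "free_algebra F =
     \<lparr>carrier = {p. range p \<subseteq> carrier F \<and> finite {w. p w \<noteq> \<zero>\<^bsub>F\<^esub>}},
      mult = (\<lambda>p q w. \<Oplus>\<^bsub>F\<^esub>k\<in>{..length w}. p (take k w) \<otimes>\<^bsub>F\<^esub> q (drop k w)),
      one = (\<lambda>w. if w = [] then \<one>\<^bsub>F\<^esub> else \<zero>\<^bsub>F\<^esub>),
      zero = (\<lambda>w. \<zero>\<^bsub>F\<^esub>),
      add = (\<lambda>p q w. p w \<oplus>\<^bsub>F\<^esub> q w)\<rparr>"

definition free_const :: "('a, 'm) ring_scheme \<Rightarrow> 'a \<Rightarrow> 'v list \<Rightarrow> 'a" where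
  "free_const F c = (\<lambda>w. if w = [] then c else \<zero>\<^bsub>F\<^esub>)"

definition free_gen :: "('a, 'm) ring_scheme \<Rightarrow> 'v \<Rightarrow> 'v list \<Rightarrow> 'a" where
  "free_gen F g = (\<lambda>w. if w = [g] then \<one>\<^bsub>F\<^esub> else \<zero>\<^bsub>F\<^esub>)"

datatype quat_letter = QI | QJ

definition quaternion_relations ::
    "('a, 'm) ring_scheme \<Rightarrow> 'a \<Rightarrow> 'a \<Rightarrow> (quat_letter list \<Rightarrow> 'a) set" where
  "quaternion_relations F \<alpha> \<beta> =
     (let A = free_algebra F; i = free_gen F QI; j = free_gen F QJ in
       {(i \<otimes>\<^bsub>A\<^esub> i) \<ominus>\<^bsub>A\<^esub> free_const F \<alpha>,
        (j \<otimes>\<^bsub>A\<^esub> j) \<ominus>\<^bsub>A\<^esub> free_const F \<beta>,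
        (j \<otimes>\<^bsub>A\<^esub> i) \<oplus>\<^bsub>A\<^esub> (i \<otimes>\<^bsub>A\<^esub> j)})"

definition quaternion_algebra ::
    "('a, 'm) ring_scheme \<Rightarrow> 'a \<Rightarrow> 'a \<Rightarrow> (quat_letter list \<Rightarrow> 'a) set ring" where
  "quaternion_algebra F \<alpha> \<beta> =
     free_algebra F Quot genideal (free_algebra F) (quaternion_relations F \<alpha> \<beta>)"

definition quaternion_division_algebra ::
    "('a, 'm) ring_scheme \<Rightarrow> (quat_letter list \<Rightarrow> 'a) set ring \<Rightarrow> bool" where
  "quaternion_division_algebra F Q \<longleftrightarrow>
     (\<exists>\<alpha>\<in>carrier F - {\<zero>\<^bsub>F\<^esub>}. \<exists>\<beta>\<in>carrier F - {\<zero>\<^bsub>F\<^esub>}. Q = quaternion_algebra F \<alpha> \<beta>)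
     \<and> division_ring Q"


section \<open>Polynomials in two central variables and their zeros\<close>

text \<open>
  \<open>D[x,y]\<close> is taken to be \<open>(D[x])[y]\<close>, so the inner exponent belongs to \<open>x\<close> and the outer one
  to \<open>y\<close>. The construction \<^const>\<open>UP\<close> needs no commutativity: its variable commutes with all
  coefficients over any ring.
\<close>

abbreviation poly2 ::
    "('a, 'm) ring_scheme \<Rightarrow> (nat \<Rightarrow> 'a, nat \<Rightarrow> nat \<Rightarrow> 'a) up_ring" where
  "poly2 D \<equiv> UP (UP D)"

definition coeff2 ::
    "('a, 'm) ring_scheme \<Rightarrow> (nat \<Rightarrow> nat \<Rightarrow> 'a) \<Rightarrow> nat \<Rightarrow> nat \<Rightarrow> 'a" where
  "coeff2 D f r s = coeff (UP D) (coeff (poly2 D) f s) r"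

definition eval2 ::
    "('a, 'm) ring_scheme \<Rightarrow> (nat \<Rightarrow> nat \<Rightarrow> 'a) \<Rightarrow> 'a \<Rightarrow> 'a \<Rightarrow> 'a" where
  "eval2 D f a b =
     finsum D (\<lambda>(r, s). coeff2 D f r s \<otimes>\<^bsub>D\<^esub> (a [^]\<^bsub>D\<^esub> r) \<otimes>\<^bsub>D\<^esub> (b [^]\<^bsub>D\<^esub> s))
       {(r, s). coeff2 D f r s \<noteq> \<zero>\<^bsub>D\<^esub>}"

definition zero_locus ::
    "('a, 'm) ring_scheme \<Rightarrow> (nat \<Rightarrow> nat \<Rightarrow> 'a) set \<Rightarrow> ('a \<times> 'a) set" where
  "zero_locus D I =
     {(a, b). a \<in> carrier D \<and> b \<in> carrier D \<and> (\<forall>f\<in>I. eval2 D f a b = \<zero>\<^bsub>D\<^esub>)}"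

definition commuting_pairs :: "('a, 'm) ring_scheme \<Rightarrow> ('a \<times> 'a) set" where
  "commuting_pairs D =
     {(a, b). a \<in> carrier D \<and> b \<in> carrier D \<and> a \<otimes>\<^bsub>D\<^esub> b = b \<otimes>\<^bsub>D\<^esub> a}"

definition commuting_zero_locus ::
    "('a, 'm) ring_scheme \<Rightarrow> (nat \<Rightarrow> nat \<Rightarrow> 'a) set \<Rightarrow> ('a \<times> 'a) set" where
  "commuting_zero_locus D I = zero_locus D I \<inter> commuting_pairs D"

definition vanishes_on ::
    "('a, 'm) ring_scheme \<Rightarrow> (nat \<Rightarrow> nat \<Rightarrow> 'a) \<Rightarrow> ('a \<times> 'a) set \<Rightarrow> bool" where
  "vanishes_on D f S \<longleftrightarrow> (\<forall>(a, b)\<in>S. eval2 D f a b = \<zero>\<^bsub>D\<^esub>)"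

end

theory Submission
  imports Defs
begin

text \<open>
  Take \<open>F\<close> to be the rational numbers, \<open>Q = (-1, -1)\<close> the rational quaternions and \<open>I\<close> the left
  ideal generated by \<open>x\<^sup>2 + 1\<close> and \<open>y\<^sup>2 + 2\<close>. Substitution is not multiplicative, so a zero of
  generators need not be a zero of the left ideal that they generate. Here it is, because each
  generator involves one variable and has central coefficients: multiplying a generator by a
  monomial \<open>c x\<^sup>r y\<^sup>s\<close> on the left and substituting \<open>(a, b)\<close> gives \<open>c a\<^sup>r (a\<^sup>2 + 1) b\<^sup>s\<close>, respectively
  \<open>c a\<^sup>r b\<^sup>s (b\<^sup>2 + 2)\<close>, whether or not \<open>a\<close> and \<open>b\<close> commute. Hence the zeros of \<open>I\<close> are
  exactly the pairs with \<open>a\<^sup>2 = -1\<close> and \<open>b\<^sup>2 = -2\<close> (lemma \<open>zero_locus_quadratic_ideal\<close>); one of them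
  is \<open>(i, i + j)\<close>. If such \<open>a\<close> and \<open>b\<close> commuted, \<open>ab\<close> would be a square root of \<open>2\<close>. A rational
  quaternion whose square is a positive rational number is itself a rational number, so the
  irrationality of \<open>\<surd>2\<close> excludes this (lemma \<open>no_commuting_roots\<close>). The constant polynomial \<open>1\<close> then vanishes on the
  empty set of commuting zeros of \<open>I\<close> and at none of its zeros.

  The algebra \<open>Q\<close> is a quotient of a free algebra by generators and relations. That it does not
  collapse, and that it is a division ring, is read off from an isomorphism with the quaternions
  with rational coordinates (lemma \<open>quaternion_algebra_iso\<close>).
\<close>

section \<open>Substitution into polynomials in two central variables\<close>

lemma (in abelian_monoid) finsum_induct:
  assumes "finite A" "\<And>k. k \<in> A \<Longrightarrow> h k \<in> carrier G" "Q \<zero>"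
    and "\<And>x y. x \<in> carrier G \<Longrightarrow> y \<in> carrier G \<Longrightarrow> Q x \<Longrightarrow> Q y \<Longrightarrow> Q (x \<oplus> y)"
    and "\<And>k. k \<in> A \<Longrightarrow> Q (h k)"
  shows "Q (finsum G h A)"
  using assms(1,2,5)
proof (induction A rule: finite_induct)
  case empty
  then show ?case using assms(3) by simp
next
  case (insert k A)
  then have "h \<in> A \<rightarrow> carrier G" by auto
  with insert show ?case by (simp add: assms(4))
qed

lemma (in UP_ring) finite_coeff_support:
  assumes "p \<in> carrier P"
  shows "finite {n. coeff P p n \<noteq> \<zero>}"
proof -
  obtain n where "bound \<zero> n (coeff P p)"
    using assms R.bound_upD[of p] by (auto simp: P_def UP_def)
  then have "{n. coeff P p n \<noteq> \<zero>} \<subseteq> {..n}"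
    using bound_below by fastforce
  then show ?thesis by (rule finite_subset) simp
qed

context ring
begin

interpretation Px: ring "UP R"
  by (rule UP_ring.UP_ring) (simp add: UP_ring_def ring_axioms)

interpretation Pxy: ring "poly2 R"
  by (rule UP_ring.UP_ring) (simp add: UP_ring_def Px.ring_axioms)

interpretation inner: UP_ring R "UP R"
  by (simp_all add: UP_ring_def ring_axioms)

interpretation outer: UP_ring "UP R" "poly2 R"
  by (simp_all add: UP_ring_def Px.ring_axioms)

definition monom2 :: "'a \<Rightarrow> nat \<Rightarrow> nat \<Rightarrow> nat \<Rightarrow> nat \<Rightarrow> 'a" where
  "monom2 c r s = monom (poly2 R) (monom (UP R) c r) s"

lemma monom2_closed [simp]: "c \<in> carrier R \<Longrightarrow> monom2 c r s \<in> carrier (poly2 R)"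
  by (simp add: monom2_def)

lemma monom2_zero: "monom2 \<zero> r s = \<zero>\<^bsub>poly2 R\<^esub>"
  by (simp add: monom2_def)

lemma coeff2_monom2:
  "c \<in> carrier R \<Longrightarrow> coeff2 R (monom2 c r s) r' s' = (if r = r' \<and> s = s' then c else \<zero>)"
  by (auto simp: coeff2_def monom2_def)

lemma coeff2_closed [simp]: "f \<in> carrier (poly2 R) \<Longrightarrow> coeff2 R f r s \<in> carrier R"
  by (simp add: coeff2_def)

lemma coeff2_add:
  "f \<in> carrier (poly2 R) \<Longrightarrow> g \<in> carrier (poly2 R) \<Longrightarrow>
    coeff2 R (f \<oplus>\<^bsub>poly2 R\<^esub> g) r s = coeff2 R f r s \<oplus> coeff2 R g r s"
  by (simp add: coeff2_def)

lemma finite_coeff2_support: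
  assumes "f \<in> carrier (poly2 R)"
  shows "finite {(r, s). coeff2 R f r s \<noteq> \<zero>}"
proof -
  have "{(r, s). coeff2 R f r s \<noteq> \<zero>} \<subseteq>
      (\<Union>s\<in>{s. coeff (poly2 R) f s \<noteq> \<zero>\<^bsub>UP R\<^esub>}. {r. coeff2 R f r s \<noteq> \<zero>} \<times> {s})"
    by (auto simp: coeff2_def)
  moreover have "finite \<dots>"
    using outer.finite_coeff_support[OF assms]
      inner.finite_coeff_support[OF outer.coeff_closed[OF assms]] by (auto simp: coeff2_def)
  ultimately show ?thesis by (rule finite_subset)
qed

lemma eval2_eq_finsum:
  assumes "f \<in> carrier (poly2 R)" "a \<in> carrier R" "b \<in> carrier R"
    and "finite S" "{(r, s). coeff2 R f r s \<noteq> \<zero>} \<subseteq> S"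
  shows "eval2 R f a b = finsum R (\<lambda>(r, s). coeff2 R f r s \<otimes> a [^] r \<otimes> b [^] s) S"
  unfolding eval2_def
  by (rule add.finprod_mono_neutral_cong_left) (use assms in auto)

lemma eval2_add:
  assumes f: "f \<in> carrier (poly2 R)" and g: "g \<in> carrier (poly2 R)"
    and a: "a \<in> carrier R" and b: "b \<in> carrier R"
  shows "eval2 R (f \<oplus>\<^bsub>poly2 R\<^esub> g) a b = eval2 R f a b \<oplus> eval2 R g a b"
proof -
  let ?S = "{(r, s). coeff2 R f r s \<noteq> \<zero>} \<union> {(r, s). coeff2 R g r s \<noteq> \<zero>}"
  have S: "finite ?S" using finite_coeff2_support f g by simp
  have "eval2 R (f \<oplus>\<^bsub>poly2 R\<^esub> g) a b =
      finsum R (\<lambda>(r, s). coeff2 R (f \<oplus>\<^bsub>poly2 R\<^esub> g) r s \<otimes> a [^] r \<otimes> b [^] s) ?S"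
    by (rule eval2_eq_finsum) (use f g a b S in \<open>auto simp: coeff2_add\<close>)
  also have "\<dots> = (\<Oplus>x\<in>?S. (case x of (r, s) \<Rightarrow> coeff2 R f r s \<otimes> a [^] r \<otimes> b [^] s)
      \<oplus> (case x of (r, s) \<Rightarrow> coeff2 R g r s \<otimes> a [^] r \<otimes> b [^] s))"
    by (rule add.finprod_cong') (use f g a b in \<open>auto simp: coeff2_add l_distr\<close>)
  also have "\<dots> = finsum R (\<lambda>(r, s). coeff2 R f r s \<otimes> a [^] r \<otimes> b [^] s) ?S
      \<oplus> finsum R (\<lambda>(r, s). coeff2 R g r s \<otimes> a [^] r \<otimes> b [^] s) ?S"
    by (rule finsum_addf) (use f g a b in auto)
  also have "\<dots> = eval2 R f a b \<oplus> eval2 R g a b"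
    using eval2_eq_finsum[OF f a b S] eval2_eq_finsum[OF g a b S] by auto
  finally show ?thesis .
qed

lemma eval2_monom2:
  assumes "c \<in> carrier R" "a \<in> carrier R" "b \<in> carrier R"
  shows "eval2 R (monom2 c r s) a b = c \<otimes> a [^] r \<otimes> b [^] s"
proof -
  have "eval2 R (monom2 c r s) a b =
      finsum R (\<lambda>(r', s'). coeff2 R (monom2 c r s) r' s' \<otimes> a [^] r' \<otimes> b [^] s') {(r, s)}"
    by (rule eval2_eq_finsum) (use assms in \<open>auto simp: coeff2_monom2 split: if_splits\<close>)
  also have "\<dots> = c \<otimes> a [^] r \<otimes> b [^] s"
    using assms by (simp add: coeff2_monom2)
  finally show ?thesis .
qed

text \<open>
  Every polynomial is a finite sum of monomials, so an additive statement about polynomials needs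
  checking on monomials only.
\<close>

lemma poly2_induct [consumes 1, case_names monom add]:
  assumes f: "f \<in> carrier (poly2 R)"
    and monom: "\<And>c r s. c \<in> carrier R \<Longrightarrow> Q (monom2 c r s)"
    and add: "\<And>f g. f \<in> carrier (poly2 R) \<Longrightarrow> g \<in> carrier (poly2 R) \<Longrightarrow> Q f \<Longrightarrow> Q g \<Longrightarrow>
        Q (f \<oplus>\<^bsub>poly2 R\<^esub> g)"
  shows "Q f"
proof -
  have Q0: "Q \<zero>\<^bsub>poly2 R\<^esub>"
    using monom[of \<zero> 0 0] by (simp add: monom2_zero)
  have outer: "Q (monom (poly2 R) p s)" if p: "p \<in> carrier (UP R)" for p s
  proof -
    have "Q (monom (poly2 R) (\<Oplus>\<^bsub>UP R\<^esub>r\<in>{..deg R p}. monom (UP R) (coeff (UP R) p r) r) s)"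
    proof (rule Px.finsum_induct[where Q = "\<lambda>p. Q (monom (poly2 R) p s)"])
      show "Q (monom (poly2 R) \<zero>\<^bsub>UP R\<^esub> s)" using Q0 by simp
    next
      fix x y
      assume "x \<in> carrier (UP R)" "y \<in> carrier (UP R)"
        "Q (monom (poly2 R) x s)" "Q (monom (poly2 R) y s)"
      then show "Q (monom (poly2 R) (x \<oplus>\<^bsub>UP R\<^esub> y) s)" using add by simp
    next
      fix k
      show "Q (monom (poly2 R) (monom (UP R) (coeff (UP R) p k) k) s)"
        using monom[of "coeff (UP R) p k" k s] p by (simp add: monom2_def)
    qed (use p in auto)
    then show ?thesis by (simp only: inner.up_repr[OF p])
  qed
  have "Q (\<Oplus>\<^bsub>poly2 R\<^esub>s\<in>{..deg (UP R) f}. monom (poly2 R) (coeff (poly2 R) f s) s)"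
    by (rule Pxy.finsum_induct[where Q = Q]) (use f Q0 add outer in auto)
  then show ?thesis by (simp only: outer.up_repr[OF f])
qed

lemma monom2_mult:
  "c \<in> carrier R \<Longrightarrow> d \<in> carrier R \<Longrightarrow>
    monom2 c r s \<otimes>\<^bsub>poly2 R\<^esub> monom2 d r' s' = monom2 (c \<otimes> d) (r + r') (s + s')"
  by (simp add: monom2_def flip: inner.monom_mult outer.monom_mult)

text \<open>
  Substitution is additive, although it is not multiplicative. Therefore the left multiples of \<open>p\<close>
  vanish at a point as soon as the multiples of \<open>p\<close> by monomials do.
\<close>

lemma eval2_mult_eq_zero:
  assumes g: "g \<in> carrier (poly2 R)" and p: "p \<in> carrier (poly2 R)"
    and a: "a \<in> carrier R" and b: "b \<in> carrier R"
    and mon: "\<And>c r s. c \<in> carrier R \<Longrightarrow> eval2 R (monom2 c r s \<otimes>\<^bsub>poly2 R\<^esub> p) a b = \<zero>"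
  shows "eval2 R (g \<otimes>\<^bsub>poly2 R\<^esub> p) a b = \<zero>"
  using g
proof (induction rule: poly2_induct)
  case (monom c r s)
  then show ?case by (rule mon)
next
  case (add f g)
  then show ?case using p a b by (simp add: Pxy.l_distr eval2_add)
qed

definition quadratic_x :: "'a \<Rightarrow> nat \<Rightarrow> nat \<Rightarrow> 'a" where
  "quadratic_x u = monom2 \<one> 2 0 \<oplus>\<^bsub>poly2 R\<^esub> monom2 u 0 0"

definition quadratic_y :: "'a \<Rightarrow> nat \<Rightarrow> nat \<Rightarrow> 'a" where
  "quadratic_y v = monom2 \<one> 0 2 \<oplus>\<^bsub>poly2 R\<^esub> monom2 v 0 0"

definition quadratic_ideal :: "'a \<Rightarrow> 'a \<Rightarrow> (nat \<Rightarrow> nat \<Rightarrow> 'a) set" where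
  "quadratic_ideal u v =
     {g \<otimes>\<^bsub>poly2 R\<^esub> quadratic_x u \<oplus>\<^bsub>poly2 R\<^esub> h \<otimes>\<^bsub>poly2 R\<^esub> quadratic_y v | g h.
        g \<in> carrier (poly2 R) \<and> h \<in> carrier (poly2 R)}"

lemma quadratic_closed [simp]:
  "u \<in> carrier R \<Longrightarrow> quadratic_x u \<in> carrier (poly2 R)"
  "v \<in> carrier R \<Longrightarrow> quadratic_y v \<in> carrier (poly2 R)"
  by (simp_all add: quadratic_x_def quadratic_y_def)

lemma left_ideal_quadratic_ideal:
  assumes "u \<in> carrier R" "v \<in> carrier R"
  shows "left_ideal (quadratic_ideal u v) (poly2 R)"
  unfolding left_ideal_def
proof (intro conjI ballI)
  let ?P = "poly2 R"
  note q = quadratic_closed(1)[OF assms(1)] quadratic_closed(2)[OF assms(2)]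
  show "additive_subgroup (quadratic_ideal u v) ?P"
  proof (rule additive_subgroupI, rule Pxy.add.subgroupI)
    show "quadratic_ideal u v \<subseteq> carrier ?P"
      using q by (auto simp: quadratic_ideal_def)
    show "quadratic_ideal u v \<noteq> {}"
      by (auto simp: quadratic_ideal_def)
  next
    fix f assume "f \<in> quadratic_ideal u v"
    then obtain g h where gh: "g \<in> carrier ?P" "h \<in> carrier ?P"
      and f: "f = g \<otimes>\<^bsub>?P\<^esub> quadratic_x u \<oplus>\<^bsub>?P\<^esub> h \<otimes>\<^bsub>?P\<^esub> quadratic_y v"
      by (auto simp: quadratic_ideal_def)
    have "\<ominus>\<^bsub>?P\<^esub> f = (\<ominus>\<^bsub>?P\<^esub> g) \<otimes>\<^bsub>?P\<^esub> quadratic_x u \<oplus>\<^bsub>?P\<^esub> (\<ominus>\<^bsub>?P\<^esub> h) \<otimes>\<^bsub>?P\<^esub> quadratic_y v"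
      using gh q by (simp add: f Pxy.minus_add Pxy.l_minus)
    with gh show "\<ominus>\<^bsub>?P\<^esub> f \<in> quadratic_ideal u v"
      unfolding quadratic_ideal_def by blast
  next
    fix f f' assume "f \<in> quadratic_ideal u v" "f' \<in> quadratic_ideal u v"
    then obtain g h g' h' where gh: "g \<in> carrier ?P" "h \<in> carrier ?P" "g' \<in> carrier ?P" "h' \<in> carrier ?P"
      and f: "f = g \<otimes>\<^bsub>?P\<^esub> quadratic_x u \<oplus>\<^bsub>?P\<^esub> h \<otimes>\<^bsub>?P\<^esub> quadratic_y v"
        "f' = g' \<otimes>\<^bsub>?P\<^esub> quadratic_x u \<oplus>\<^bsub>?P\<^esub> h' \<otimes>\<^bsub>?P\<^esub> quadratic_y v"
      by (auto simp: quadratic_ideal_def)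
    have "f \<oplus>\<^bsub>?P\<^esub> f' = (g \<oplus>\<^bsub>?P\<^esub> g') \<otimes>\<^bsub>?P\<^esub> quadratic_x u \<oplus>\<^bsub>?P\<^esub> (h \<oplus>\<^bsub>?P\<^esub> h') \<otimes>\<^bsub>?P\<^esub> quadratic_y v"
      using gh q by (simp add: f Pxy.l_distr Pxy.a_ac)
    moreover have "g \<oplus>\<^bsub>?P\<^esub> g' \<in> carrier ?P" "h \<oplus>\<^bsub>?P\<^esub> h' \<in> carrier ?P"
      using gh by auto
    ultimately show "f \<oplus>\<^bsub>?P\<^esub> f' \<in> quadratic_ideal u v"
      unfolding quadratic_ideal_def by blast
  qed
next
  let ?P = "poly2 R"
  note q = quadratic_closed(1)[OF assms(1)] quadratic_closed(2)[OF assms(2)]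
  fix k f assume k: "k \<in> carrier ?P" and "f \<in> quadratic_ideal u v"
  then obtain g h where gh: "g \<in> carrier ?P" "h \<in> carrier ?P"
    and f: "f = g \<otimes>\<^bsub>?P\<^esub> quadratic_x u \<oplus>\<^bsub>?P\<^esub> h \<otimes>\<^bsub>?P\<^esub> quadratic_y v"
    by (auto simp: quadratic_ideal_def)
  have "k \<otimes>\<^bsub>?P\<^esub> f = (k \<otimes>\<^bsub>?P\<^esub> g) \<otimes>\<^bsub>?P\<^esub> quadratic_x u \<oplus>\<^bsub>?P\<^esub> (k \<otimes>\<^bsub>?P\<^esub> h) \<otimes>\<^bsub>?P\<^esub> quadratic_y v"
    using gh q k by (simp add: f Pxy.r_distr Pxy.m_assoc)
  moreover have "k \<otimes>\<^bsub>?P\<^esub> g \<in> carrier ?P" "k \<otimes>\<^bsub>?P\<^esub> h \<in> carrier ?P"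
    using gh k by auto
  ultimately show "k \<otimes>\<^bsub>?P\<^esub> f \<in> quadratic_ideal u v"
    unfolding quadratic_ideal_def by blast
qed

text \<open>
  Centrality of \<open>u\<close> and \<open>v\<close> makes the values of the monomial multiples of the generators factor
  through the values of the generators. No commutation of \<open>a\<close> with \<open>b\<close> enters: in
  \<open>a\<^sup>r b\<^sup>s\<close> the new factor \<open>a\<^sup>2\<close> joins the powers of \<open>a\<close>, and \<open>b\<^sup>2\<close> those of \<open>b\<close>.
\<close>

lemma zero_locus_quadratic_ideal:
  assumes u: "u \<in> carrier R" and v: "v \<in> carrier R"
    and cu: "\<And>a. a \<in> carrier R \<Longrightarrow> u \<otimes> a = a \<otimes> u"
    and cv: "\<And>a. a \<in> carrier R \<Longrightarrow> v \<otimes> a = a \<otimes> v"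
  shows "zero_locus R (quadratic_ideal u v) =
    {(a, b). a \<in> carrier R \<and> b \<in> carrier R \<and> a \<otimes> a \<oplus> u = \<zero> \<and> b \<otimes> b \<oplus> v = \<zero>}"
proof -
  let ?P = "poly2 R"
  note q = quadratic_closed(1)[OF u] quadratic_closed(2)[OF v]
  have eval: "eval2 R (quadratic_x u) a b = a \<otimes> a \<oplus> u" "eval2 R (quadratic_y v) a b = b \<otimes> b \<oplus> v"
    if "a \<in> carrier R" "b \<in> carrier R" for a b
    using that u v
    by (simp_all add: quadratic_x_def quadratic_y_def eval2_add eval2_monom2 numeral_2_eq_2)
  have mem: "quadratic_x u \<in> quadratic_ideal u v" "quadratic_y v \<in> quadratic_ideal u v"
  proof -
    have "quadratic_x u = \<one>\<^bsub>?P\<^esub> \<otimes>\<^bsub>?P\<^esub> quadratic_x u \<oplus>\<^bsub>?P\<^esub> \<zero>\<^bsub>?P\<^esub> \<otimes>\<^bsub>?P\<^esub> quadratic_y v"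
      using q by simp
    then show "quadratic_x u \<in> quadratic_ideal u v"
      unfolding quadratic_ideal_def using Pxy.one_closed Pxy.zero_closed by blast
    have "quadratic_y v = \<zero>\<^bsub>?P\<^esub> \<otimes>\<^bsub>?P\<^esub> quadratic_x u \<oplus>\<^bsub>?P\<^esub> \<one>\<^bsub>?P\<^esub> \<otimes>\<^bsub>?P\<^esub> quadratic_y v"
      using q by simp
    then show "quadratic_y v \<in> quadratic_ideal u v"
      unfolding quadratic_ideal_def using Pxy.one_closed Pxy.zero_closed by blast
  qed
  have vanish: "eval2 R f a b = \<zero>"
    if f: "f \<in> quadratic_ideal u v" and a: "a \<in> carrier R" and b: "b \<in> carrier R"
      and aa: "a \<otimes> a \<oplus> u = \<zero>" and bb: "b \<otimes> b \<oplus> v = \<zero>" for f a b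
  proof -
    have ev_mon: "eval2 R (monom2 c r s \<otimes>\<^bsub>?P\<^esub> quadratic_x u) a b = c \<otimes> a [^] r \<otimes> (a \<otimes> a \<oplus> u) \<otimes> b [^] s"
      "eval2 R (monom2 c r s \<otimes>\<^bsub>?P\<^esub> quadratic_y v) a b = c \<otimes> a [^] r \<otimes> b [^] s \<otimes> (b \<otimes> b \<oplus> v)"
      if c: "c \<in> carrier R" for c r s
    proof -
      have pw: "a [^] r \<in> carrier R" "b [^] s \<in> carrier R" using a b by auto
      have "eval2 R (monom2 c r s \<otimes>\<^bsub>?P\<^esub> quadratic_x u) a b
          = c \<otimes> a [^] (r + 2) \<otimes> b [^] s \<oplus> (c \<otimes> u) \<otimes> a [^] r \<otimes> b [^] s"
        using a b c u by (simp add: quadratic_x_def Pxy.r_distr monom2_mult eval2_add eval2_monom2)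
      also have "a [^] (r + 2) = a [^] r \<otimes> (a \<otimes> a)"
        using a by (simp add: numeral_2_eq_2 m_assoc)
      also have "(c \<otimes> u) \<otimes> a [^] r = c \<otimes> (a [^] r \<otimes> u)"
        using c u pw cu by (simp add: m_assoc)
      finally show "eval2 R (monom2 c r s \<otimes>\<^bsub>?P\<^esub> quadratic_x u) a b
          = c \<otimes> a [^] r \<otimes> (a \<otimes> a \<oplus> u) \<otimes> b [^] s"
        using a b c u pw by (simp add: l_distr r_distr m_assoc)
      have "eval2 R (monom2 c r s \<otimes>\<^bsub>?P\<^esub> quadratic_y v) a b
          = c \<otimes> a [^] r \<otimes> b [^] (s + 2) \<oplus> (c \<otimes> v) \<otimes> a [^] r \<otimes> b [^] s"
        using a b c v by (simp add: quadratic_y_def Pxy.r_distr monom2_mult eval2_add eval2_monom2)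
      also have "b [^] (s + 2) = b [^] s \<otimes> (b \<otimes> b)"
        using b by (simp add: numeral_2_eq_2 m_assoc)
      also have "(c \<otimes> v) \<otimes> a [^] r \<otimes> b [^] s = c \<otimes> (a [^] r \<otimes> b [^] s \<otimes> v)"
        using c v pw cv[of "a [^] r \<otimes> b [^] s"] by (simp add: m_assoc)
      finally show "eval2 R (monom2 c r s \<otimes>\<^bsub>?P\<^esub> quadratic_y v) a b
          = c \<otimes> a [^] r \<otimes> b [^] s \<otimes> (b \<otimes> b \<oplus> v)"
        using a b c v pw by (simp add: l_distr r_distr m_assoc)
    qed
    obtain g h where gh: "g \<in> carrier ?P" "h \<in> carrier ?P"
      and "f = g \<otimes>\<^bsub>?P\<^esub> quadratic_x u \<oplus>\<^bsub>?P\<^esub> h \<otimes>\<^bsub>?P\<^esub> quadratic_y v"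
      using f by (auto simp: quadratic_ideal_def)
    then have "eval2 R f a b = eval2 R (g \<otimes>\<^bsub>?P\<^esub> quadratic_x u) a b \<oplus> eval2 R (h \<otimes>\<^bsub>?P\<^esub> quadratic_y v) a b"
      using a b q by (simp add: eval2_add)
    also have "eval2 R (g \<otimes>\<^bsub>?P\<^esub> quadratic_x u) a b = \<zero>"
      by (rule eval2_mult_eq_zero[OF gh(1) q(1) a b]) (use a b aa in \<open>simp add: ev_mon\<close>)
    also have "eval2 R (h \<otimes>\<^bsub>?P\<^esub> quadratic_y v) a b = \<zero>"
      by (rule eval2_mult_eq_zero[OF gh(2) q(2) a b]) (use a b bb in \<open>simp add: ev_mon\<close>)
    finally show ?thesis by simp
  qed
  have "(a, b) \<in> zero_locus R (quadratic_ideal u v) \<longleftrightarrow>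
      a \<in> carrier R \<and> b \<in> carrier R \<and> a \<otimes> a \<oplus> u = \<zero> \<and> b \<otimes> b \<oplus> v = \<zero>" for a b
  proof
    assume "(a, b) \<in> zero_locus R (quadratic_ideal u v)"
    then have "a \<in> carrier R" "b \<in> carrier R"
      "eval2 R (quadratic_x u) a b = \<zero>" "eval2 R (quadratic_y v) a b = \<zero>"
      using mem by (auto simp: zero_locus_def)
    then show "a \<in> carrier R \<and> b \<in> carrier R \<and> a \<otimes> a \<oplus> u = \<zero> \<and> b \<otimes> b \<oplus> v = \<zero>"
      using eval by simp
  next
    assume "a \<in> carrier R \<and> b \<in> carrier R \<and> a \<otimes> a \<oplus> u = \<zero> \<and> b \<otimes> b \<oplus> v = \<zero>"
    then show "(a, b) \<in> zero_locus R (quadratic_ideal u v)"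
      using vanish by (auto simp: zero_locus_def)
  qed
  then show ?thesis by auto
qed

end

section \<open>The division ring of rational quaternions\<close>

definition type_subring :: "'a set \<Rightarrow> 'a::ring_1 ring" where
  "type_subring S = \<lparr>carrier = S, mult = (*), one = 1, zero = 0, add = (+)\<rparr>"

lemma type_subring_simps [simp]:
  "carrier (type_subring S) = S" "mult (type_subring S) = (*)" "one (type_subring S) = 1"
  "zero (type_subring S) = 0" "add (type_subring S) = (+)"
  by (simp_all add: type_subring_def)

lemma ring_type_subring:
  assumes "1 \<in> S" "\<And>a b. a \<in> S \<Longrightarrow> b \<in> S \<Longrightarrow> a - b \<in> S" "\<And>a b. a \<in> S \<Longrightarrow> b \<in> S \<Longrightarrow> a * b \<in> S"
  shows "ring (type_subring S)"
proof -
  have 0: "0 \<in> S" using assms(2)[OF assms(1) assms(1)] by simp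
  have uminus: "- a \<in> S" if "a \<in> S" for a using assms(2)[OF 0 that] by simp
  have add: "a + b \<in> S" if "a \<in> S" "b \<in> S" for a b
    using assms(2)[OF that(1) uminus[OF that(2)]] by simp
  show ?thesis
    by (intro ringI abelian_groupI monoidI)
      (auto simp: assms 0 add algebra_simps intro!: bexI[OF _ uminus])
qed

datatype quat = Quat (qre: real) (qi: real) (qj: real) (qk: real)

lemma quat_eq_iff: "p = q \<longleftrightarrow> qre p = qre q \<and> qi p = qi q \<and> qj p = qj q \<and> qk p = qk q"
  by (cases p; cases q) simp

instantiation quat :: real_div_algebra
begin

definition "0 = Quat 0 0 0 0"
definition "1 = Quat 1 0 0 0"
definition "p + q = Quat (qre p + qre q) (qi p + qi q) (qj p + qj q) (qk p + qk q)"
definition "- p = Quat (- qre p) (- qi p) (- qj p) (- qk p)"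
definition "p - q = Quat (qre p - qre q) (qi p - qi q) (qj p - qj q) (qk p - qk q)"
definition "c *\<^sub>R p = Quat (c * qre p) (c * qi p) (c * qj p) (c * qk p)"
definition "p * q = Quat
  (qre p * qre q - qi p * qi q - qj p * qj q - qk p * qk q)
  (qre p * qi q + qi p * qre q + qj p * qk q - qk p * qj q)
  (qre p * qj q - qi p * qk q + qj p * qre q + qk p * qi q)
  (qre p * qk q + qi p * qj q - qj p * qi q + qk p * qre q)"
definition
  "inverse p = (1 / ((qre p)\<^sup>2 + (qi p)\<^sup>2 + (qj p)\<^sup>2 + (qk p)\<^sup>2)) *\<^sub>R Quat (qre p) (- qi p) (- qj p) (- qk p)"
definition "p div q = p * inverse (q :: quat)"

lemmas quat_defs = zero_quat_def one_quat_def plus_quat_def uminus_quat_def minus_quat_def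
  scaleR_quat_def times_quat_def

instance
proof
  fix p q r :: quat and a b :: real
  show "p + q + r = p + (q + r)" "p + q = q + p" "0 + p = p" "- p + p = 0" "p - q = p + - q"
    "a *\<^sub>R (p + q) = a *\<^sub>R p + a *\<^sub>R q" "(a + b) *\<^sub>R p = a *\<^sub>R p + b *\<^sub>R p"
    "a *\<^sub>R b *\<^sub>R p = (a * b) *\<^sub>R p" "1 *\<^sub>R p = p" "(0::quat) \<noteq> 1"
    "1 * p = p" "p * 1 = p"
    by (simp_all add: quat_defs algebra_simps)
  show "p * q * r = p * (q * r)" "(p + q) * r = p * r + q * r" "p * (q + r) = p * q + p * r"
    by (simp_all add: quat_defs algebra_simps)
  have scale: "a *\<^sub>R p * q = a *\<^sub>R (p * q)" "p * a *\<^sub>R q = a *\<^sub>R (p * q)" for a and p q :: quat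
    by (simp_all add: quat_defs algebra_simps)
  show "a *\<^sub>R p * q = a *\<^sub>R (p * q)" "p * a *\<^sub>R q = a *\<^sub>R (p * q)"
    by (rule scale)+
  show "p div q = p * inverse q" by (simp add: divide_quat_def)
  show "inverse (0::quat) = 0" by (simp add: inverse_quat_def quat_defs)
  define N where "N = (qre p)\<^sup>2 + (qi p)\<^sup>2 + (qj p)\<^sup>2 + (qk p)\<^sup>2"
  let ?c = "Quat (qre p) (- qi p) (- qj p) (- qk p)"
  assume "p \<noteq> 0"
  then have "N \<noteq> 0"
    by (simp add: N_def quat_eq_iff quat_defs add_nonneg_eq_0_iff)
  moreover have "inverse p = (1 / N) *\<^sub>R ?c"
    by (simp add: inverse_quat_def N_def)
  moreover have "?c * p = N *\<^sub>R 1" "p * ?c = N *\<^sub>R 1"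
    by (simp_all add: quat_defs N_def power2_eq_square)
  moreover have "(1 / N) *\<^sub>R (N *\<^sub>R (1 :: quat)) = 1" if "N \<noteq> 0"
    using that by (simp add: quat_defs)
  ultimately show "inverse p * p = 1" "p * inverse p = 1"
    by (simp_all add: scale)
qed

end

definition rational_quats :: "quat set" where
  "rational_quats = {q. qre q \<in> \<rat> \<and> qi q \<in> \<rat> \<and> qj q \<in> \<rat> \<and> qk q \<in> \<rat>}"

abbreviation rationals :: "real ring" where "rationals \<equiv> type_subring \<rat>"

abbreviation rational_quaternions :: "quat ring" where "rational_quaternions \<equiv> type_subring rational_quats"

lemma rational_quats_closed:
  "1 \<in> rational_quats" "0 \<in> rational_quats"
  "p \<in> rational_quats \<Longrightarrow> q \<in> rational_quats \<Longrightarrow> p + q \<in> rational_quats"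
  "p \<in> rational_quats \<Longrightarrow> q \<in> rational_quats \<Longrightarrow> p - q \<in> rational_quats"
  "p \<in> rational_quats \<Longrightarrow> q \<in> rational_quats \<Longrightarrow> p * q \<in> rational_quats"
  "c \<in> \<rat> \<Longrightarrow> q \<in> rational_quats \<Longrightarrow> c *\<^sub>R q \<in> rational_quats"
  "q \<in> rational_quats \<Longrightarrow> inverse q \<in> rational_quats"
  by (auto simp: rational_quats_def quat_defs inverse_quat_def power2_eq_square)

lemma field_rationals: "field rationals"
proof -
  have "ring rationals" by (rule ring_type_subring) auto
  moreover have "comm_monoid rationals" by (rule comm_monoidI) auto
  ultimately interpret cring rationals by (rule cring.intro)
  show ?thesis
  proof (rule cring_fieldI)
    show "Units rationals = carrier rationals - {\<zero>\<^bsub>rationals\<^esub>}"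
    proof (intro equalityI subsetI)
      fix x assume "x \<in> carrier rationals - {\<zero>\<^bsub>rationals\<^esub>}"
      then show "x \<in> Units rationals"
        by (auto simp: Units_def intro!: bexI[of _ "inverse x"])
    qed (auto simp: Units_def)
  qed
qed

lemma ring_rational_quaternions: "ring rational_quaternions"
  by (rule ring_type_subring) (auto intro: rational_quats_closed)

lemma division_ring_rational_quaternions: "division_ring rational_quaternions"
  unfolding division_ring_def
proof (intro conjI equalityI subsetI)
  fix q assume "q \<in> carrier rational_quaternions - {\<zero>\<^bsub>rational_quaternions\<^esub>}"
  then show "q \<in> Units rational_quaternions"
    by (auto simp: Units_def rational_quats_closed intro!: bexI[of _ "inverse q"])
qed (auto simp: Units_def ring_rational_quaternions)

lemma rat_square_ne_2: assumes "t \<in> \<rat>" shows "(t::real) * t \<noteq> 2"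
proof
  assume t: "t * t = 2"
  obtain m n :: nat where n: "n \<noteq> 0" and mn: "\<bar>t\<bar> = real m / real n" and co: "coprime m n"
    using Rats_abs_nat_div_natE[OF assms] by blast
  have "(real m / real n) * (real m / real n) = 2"
    unfolding mn[symmetric] using t by simp
  then have "real m * real m = 2 * (real n * real n)"
    using n by (simp add: field_simps)
  then have "real (m * m) = real (2 * (n * n))" by simp
  then have mm: "m * m = 2 * (n * n)" by (rule of_nat_eq_iff[THEN iffD1])
  then have "even m" by (metis dvd_triv_left even_mult_iff)
  then obtain k where "m = 2 * k" by blast
  with mm have "n * n = 2 * (k * k)" by simp
  then have "even n" by (metis dvd_triv_left even_mult_iff)
  with \<open>even m\<close> coprime_common_divisor[OF co, of 2] show False by simp
qed

text \<open>
  The product \<open>z\<close> of commuting roots satisfies \<open>z\<^sup>2 = (-1) (-2) = 2\<close>. The square of a quaternion is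
  real only if its real part or its vector part is zero. In the first case the square is not
  positive, in the second \<open>z\<close> is a rational number.
\<close>

lemma no_commuting_roots:
  assumes "p \<in> rational_quats" "q \<in> rational_quats" "p * p = - 1" "q * q = - 2" "p * q = q * p"
  shows False
proof -
  define z where "z = p * q"
  have z: "z \<in> rational_quats" using assms by (simp add: z_def rational_quats_closed)
  have "z * z = (p * p) * (q * q)"
    using assms(5) by (simp add: z_def mult.assoc) (metis mult.assoc)
  also have "\<dots> = 1 + 1" using assms by simp
  finally have zz: "z * z = 1 + 1" .
  show False
  proof (cases "qre z = 0")
    case True
    then have "- (qi z * qi z) - qj z * qj z - qk z * qk z = 2"
      using zz by (simp add: quat_defs)
    then show False
      using zero_le_square[of "qi z"] zero_le_square[of "qj z"] zero_le_square[of "qk z"] by linarith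
  next
    case False
    then have "qi z = 0" "qj z = 0" "qk z = 0" "qre z * qre z = 2"
      using zz by (auto simp: quat_defs)
    moreover have "qre z \<in> \<rat>" using z by (simp add: rational_quats_def)
    ultimately show False using rat_square_ne_2 by blast
  qed
qed

section \<open>The free algebra over the rational numbers\<close>

lemma finsum_type_subring:
  assumes "ring (type_subring S)" "\<And>x. x \<in> A \<Longrightarrow> f x \<in> S"
  shows "finsum (type_subring S) f A = sum f A"
proof (cases "finite A")
  case True
  interpret ring "type_subring S" by fact
  show ?thesis using True assms(2)
  proof (induction A rule: finite_induct)
    case empty
    show ?case using finsum_empty by simp
  next
    case (insert x A)
    then have "f \<in> A \<rightarrow> carrier (type_subring S)" "f x \<in> carrier (type_subring S)" by auto
    with insert show ?case using finsum_insert[of A x f] by simp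
  qed
next
  case False
  interpret ring "type_subring S" by fact
  show ?thesis using False finsum_infinite by simp
qed

text \<open>
  The product of the free algebra, on all real functions on words. The linearity laws and the
  associativity of the convolution then hold without conditions on supports.
\<close>

definition conv :: "('v list \<Rightarrow> real) \<Rightarrow> ('v list \<Rightarrow> real) \<Rightarrow> 'v list \<Rightarrow> real" where
  "conv p q w = (\<Sum>k\<le>length w. p (take k w) * q (drop k w))"

lemma conv_Nil: "conv p q [] = p [] * q []"
  by (simp add: conv_def)

text \<open>
  This recursion on the word turns associativity and the unit laws into simple inductions.
\<close>

lemma conv_Cons: "conv p q (x # w) = p [] * q (x # w) + conv (\<lambda>u. p (x # u)) q w"
  by (simp add: conv_def sum.atMost_Suc_shift del: sum.atMost_Suc)

lemma conv_add_left: "conv (\<lambda>w. p w + q w) r w = conv p r w + conv q r w"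
  by (simp add: conv_def distrib_right sum.distrib)

lemma conv_add_right: "conv r (\<lambda>w. p w + q w) w = conv r p w + conv r q w"
  by (simp add: conv_def distrib_left sum.distrib)

lemma conv_diff_right: "conv r (\<lambda>w. p w - q w) w = conv r p w - conv r q w"
  by (simp add: conv_def right_diff_distrib sum_subtractf)

lemma conv_scale_left: "conv (\<lambda>w. c * p w) r w = c * conv p r w"
  by (simp add: conv_def sum_distrib_left mult.assoc)

lemma conv_scale_right: "conv r (\<lambda>w. c * p w) w = c * conv r p w"
  by (simp add: conv_def sum_distrib_left ac_simps)

lemma conv_assoc: "conv (conv p q) r w = conv p (conv q r) w"
proof (induction w arbitrary: p)
  case Nil
  then show ?case by (simp add: conv_Nil)
next
  case (Cons x w)
  have "(\<lambda>u. conv p q (x # u)) = (\<lambda>u. p [] * q (x # u) + conv (\<lambda>u. p (x # u)) q u)"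
    by (simp add: conv_Cons)
  then have "conv (conv p q) r (x # w) =
      p [] * q [] * r (x # w) + (p [] * conv (\<lambda>u. q (x # u)) r w + conv (conv (\<lambda>u. p (x # u)) q) r w)"
    by (simp add: conv_Cons conv_Nil conv_add_left conv_scale_left)
  also have "\<dots> = conv p (conv q r) (x # w)"
    by (simp add: conv_Cons Cons.IH distrib_left)
  finally show ?case .
qed

definition word :: "'v list \<Rightarrow> 'v list \<Rightarrow> real" where
  "word u = (\<lambda>w. if w = u then 1 else 0)"

lemma conv_Nil_left: "conv (word []) p = p"
proof
  fix w
  have "conv (\<lambda>u. 0) p v = 0" for v by (simp add: conv_def)
  then show "conv (word []) p w = p w"
    by (cases w) (simp_all add: conv_Nil conv_Cons word_def)
qed

lemma conv_word_Cons:
  "conv (word (l # u)) p w = (case w of [] \<Rightarrow> 0 | x # v \<Rightarrow> if x = l then conv (word u) p v else 0)"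
proof -
  have "conv (\<lambda>u. 0) p v = 0" for v by (simp add: conv_def)
  moreover have "(\<lambda>v. if v = u then 1 else 0) = word u" by (auto simp: word_def)
  ultimately show ?thesis
    by (cases w) (auto simp: conv_Nil conv_Cons word_def)
qed

lemma conv_word_word: "conv (word u) (word v) = word (u @ v)"
proof (induction u)
  case Nil
  then show ?case by (simp add: conv_Nil_left)
next
  case (Cons l u)
  have "conv (word (l # u)) (word v) w = word ((l # u) @ v) w" for w
    by (cases w) (simp_all add: conv_word_Cons Cons.IH, simp_all add: word_def)
  then show ?case by blast
qed

lemma conv_Nil_right: "conv p (word []) = p"
proof
  fix w show "conv p (word []) w = p w"
    by (induction w arbitrary: p) (simp_all add: conv_Nil conv_Cons word_def)
qed

abbreviation free_rational :: "('v list \<Rightarrow> real) ring" where "free_rational \<equiv> free_algebra rationals"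

lemma free_rational_simps:
  "carrier free_rational = {p. range p \<subseteq> \<rat> \<and> finite {w. p w \<noteq> 0}}"
  "one free_rational = word []" "zero free_rational = (\<lambda>w. 0)" "add free_rational p q = (\<lambda>w. p w + q w)"
  by (simp_all add: free_algebra_def word_def cong: if_cong)

lemma free_rational_rational: "p \<in> carrier free_rational \<Longrightarrow> p w \<in> \<rat>"
  by (auto simp: free_rational_simps)

lemma free_rational_I: "(\<And>w. p w \<in> \<rat>) \<Longrightarrow> finite {w. p w \<noteq> 0} \<Longrightarrow> p \<in> carrier free_rational"
  by (auto simp: free_rational_simps)

lemma free_rational_mult:
  assumes "p \<in> carrier free_rational" "q \<in> carrier free_rational"
  shows "mult free_rational p q = conv p q"
proof
  fix w
  have ring: "ring rationals" by (rule ring_type_subring) auto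
  show "mult free_rational p q w = conv p q w"
    unfolding free_algebra_def conv_def ring_record_simps monoid.simps type_subring_simps
    by (rule finsum_type_subring[OF ring]) (use assms in \<open>simp add: free_rational_rational\<close>)
qed

lemma conv_support:
  "{w. conv p q w \<noteq> 0} \<subseteq> (\<lambda>(u, v). u @ v) ` ({u. p u \<noteq> 0} \<times> {v. q v \<noteq> 0})"
proof
  fix w assume "w \<in> {w. conv p q w \<noteq> 0}"
  then obtain k where "p (take k w) * q (drop k w) \<noteq> 0"
    unfolding conv_def by (metis (mono_tags, lifting) mem_Collect_eq sum.neutral)
  then show "w \<in> (\<lambda>(u, v). u @ v) ` ({u. p u \<noteq> 0} \<times> {v. q v \<noteq> 0})"
    by (intro image_eqI[of _ _ "(take k w, drop k w)"]) auto
qed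

lemma free_rational_closed:
  "word u \<in> carrier free_rational" "(\<lambda>w. 0) \<in> carrier free_rational"
  "c \<in> \<rat> \<Longrightarrow> p \<in> carrier free_rational \<Longrightarrow> (\<lambda>w. c * p w) \<in> carrier free_rational"
  "p \<in> carrier free_rational \<Longrightarrow> q \<in> carrier free_rational \<Longrightarrow> (\<lambda>w. p w + q w) \<in> carrier free_rational"
  "p \<in> carrier free_rational \<Longrightarrow> q \<in> carrier free_rational \<Longrightarrow> (\<lambda>w. p w - q w) \<in> carrier free_rational"
  "p \<in> carrier free_rational \<Longrightarrow> q \<in> carrier free_rational \<Longrightarrow> conv p q \<in> carrier free_rational"
proof -
  show "word u \<in> carrier free_rational" "(\<lambda>w. 0) \<in> carrier free_rational"
    by (auto simp: free_rational_simps word_def)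
  show "c \<in> \<rat> \<Longrightarrow> p \<in> carrier free_rational \<Longrightarrow> (\<lambda>w. c * p w) \<in> carrier free_rational"
    by (auto simp: free_rational_simps intro!: Rats_mult)
  assume p: "p \<in> carrier free_rational" and q: "q \<in> carrier free_rational"
  have fin: "finite ({w. p w \<noteq> 0} \<union> {w. q w \<noteq> 0})" using p q by (simp add: free_rational_simps)
  show "(\<lambda>w. p w + q w) \<in> carrier free_rational" "(\<lambda>w. p w - q w) \<in> carrier free_rational"
    using p q by (auto intro!: free_rational_I intro: Rats_add Rats_diff free_rational_rational finite_subset[OF _ fin])
  have "finite {w. conv p q w \<noteq> 0}"
    by (rule finite_subset[OF conv_support]) (use p q in \<open>auto simp: free_rational_simps\<close>)
  moreover have "conv p q w \<in> \<rat>" for w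
    unfolding conv_def using p q by (intro Rats_sum Rats_mult free_rational_rational)
  ultimately show "conv p q \<in> carrier free_rational" by (auto simp: free_rational_simps)
qed

lemma ring_free_rational: "ring free_rational"
proof (intro ringI abelian_groupI monoidI)
  fix p :: "'a list \<Rightarrow> real" assume p: "p \<in> carrier free_rational"
  show "\<exists>q\<in>carrier free_rational. q \<oplus>\<^bsub>free_rational\<^esub> p = \<zero>\<^bsub>free_rational\<^esub>"
    by (rule bexI[of _ "\<lambda>w. 0 - p w"]) (use free_rational_closed(5)[OF free_rational_closed(2) p] in \<open>auto simp: free_rational_simps\<close>)
qed (auto simp: free_rational_simps(2-) free_rational_mult free_rational_closed conv_assoc conv_Nil_left conv_Nil_right
    conv_add_left conv_add_right fun_eq_iff)

lemma free_rational_minus: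
  assumes "p \<in> carrier free_rational" "q \<in> carrier free_rational"
  shows "p \<ominus>\<^bsub>free_rational\<^esub> q = (\<lambda>w. p w - q w)"
proof -
  interpret ring free_rational by (rule ring_free_rational)
  have "\<ominus>\<^bsub>free_rational\<^esub> q = (\<lambda>w. 0 - q w)"
    by (rule minus_equality) (use free_rational_closed(5)[OF free_rational_closed(2) assms(2)] assms(2) in \<open>auto simp: free_rational_simps\<close>)
  then show ?thesis by (simp add: a_minus_def free_rational_simps)
qed

section \<open>The quaternion algebra as the rational quaternions\<close>

fun letter :: "quat_letter \<Rightarrow> quat" where
  "letter QI = Quat 0 1 0 0"
| "letter QJ = Quat 0 0 1 0"

definition word_value :: "quat_letter list \<Rightarrow> quat" where
  "word_value w = prod_list (map letter w)"

lemma word_value_simps [simp]: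
  "word_value [] = 1" "word_value (l # w) = letter l * word_value w"
  "word_value (u @ v) = word_value u * word_value v"
  by (simp_all add: word_value_def)

lemma word_value_rational: "word_value w \<in> rational_quats"
proof (induction w)
  case (Cons l w)
  have "letter l \<in> rational_quats" by (cases l) (auto simp: rational_quats_def)
  with Cons show ?case by (simp add: rational_quats_closed)
qed (simp add: rational_quats_closed)

definition quat_eval :: "(quat_letter list \<Rightarrow> real) \<Rightarrow> quat" where
  "quat_eval p = (\<Sum>w | p w \<noteq> 0. p w *\<^sub>R word_value w)"

lemma quat_eval_eq_sum:
  assumes "finite S" "{w. p w \<noteq> 0} \<subseteq> S"
  shows "quat_eval p = (\<Sum>w\<in>S. p w *\<^sub>R word_value w)"
  unfolding quat_eval_def by (rule sum.mono_neutral_left) (use assms in auto)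

lemma quat_eval_add:
  assumes "p \<in> carrier free_rational" "q \<in> carrier free_rational"
  shows "quat_eval (\<lambda>w. p w + q w) = quat_eval p + quat_eval q"
proof -
  let ?S = "{w. p w \<noteq> 0} \<union> {w. q w \<noteq> 0}"
  have S: "finite ?S" using assms by (simp add: free_rational_simps)
  have "quat_eval (\<lambda>w. p w + q w) = (\<Sum>w\<in>?S. (p w + q w) *\<^sub>R word_value w)"
    by (rule quat_eval_eq_sum[OF S]) auto
  then show ?thesis
    using quat_eval_eq_sum[OF S, of p] quat_eval_eq_sum[OF S, of q]
    by (simp add: scaleR_left_distrib sum.distrib)
qed

text \<open>
  Both sides are sums over pairs of words from the supports. Collecting the pairs by their
  concatenation \<open>w\<close> leaves, as the coefficient of \<open>w\<close>, the sum over the ways of splitting \<open>w\<close>.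
\<close>

lemma quat_eval_mult:
  assumes p: "p \<in> carrier free_rational" and q: "q \<in> carrier free_rational"
  shows "quat_eval (conv p q) = quat_eval p * quat_eval q"
proof -
  let ?A = "{u. p u \<noteq> 0}" and ?B = "{v. q v \<noteq> 0}"
  let ?app = "\<lambda>(u, v). u @ v"
  have fin: "finite ?A" "finite ?B" using p q by (simp_all add: free_rational_simps)
  have inner: "(\<Sum>x\<in>{x \<in> ?A \<times> ?B. ?app x = w}. p (fst x) * q (snd x)) = conv p q w" for w
  proof -
    let ?split = "\<lambda>k. (take k w, drop k w)"
    have inj: "inj_on ?split {..length w}"
      by (rule inj_onI) (metis Pair_inject atMost_iff length_take min.absorb2)
    have "conv p q w = (\<Sum>x\<in>?split ` {..length w}. p (fst x) * q (snd x))"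
      by (simp add: conv_def sum.reindex[OF inj])
    also have "\<dots> = (\<Sum>x\<in>{x \<in> ?A \<times> ?B. ?app x = w}. p (fst x) * q (snd x))"
    proof (rule sum.mono_neutral_right)
      show "{x \<in> ?A \<times> ?B. ?app x = w} \<subseteq> ?split ` {..length w}"
      proof
        fix x assume "x \<in> {x \<in> ?A \<times> ?B. ?app x = w}"
        then show "x \<in> ?split ` {..length w}"
          by (intro image_eqI[of _ _ "length (fst x)"]) auto
      qed
    qed auto
    finally show ?thesis by simp
  qed
  have "quat_eval p * quat_eval q =
      (\<Sum>x\<in>?A \<times> ?B. (p (fst x) * q (snd x)) *\<^sub>R word_value (?app x))"
    by (simp add: quat_eval_def sum_product sum.cartesian_product case_prod_unfold mult.commute)
  also have "\<dots> = (\<Sum>w\<in>?app ` (?A \<times> ?B). \<Sum>x\<in>{x \<in> ?A \<times> ?B. ?app x = w}.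
      (p (fst x) * q (snd x)) *\<^sub>R word_value (?app x))"
    by (rule sum.image_gen) (use fin in simp)
  also have "\<dots> = (\<Sum>w\<in>?app ` (?A \<times> ?B). conv p q w *\<^sub>R word_value w)"
  proof (rule sum.cong[OF refl])
    fix w
    have "(\<Sum>x\<in>{x \<in> ?A \<times> ?B. ?app x = w}. (p (fst x) * q (snd x)) *\<^sub>R word_value (?app x)) =
        (\<Sum>x\<in>{x \<in> ?A \<times> ?B. ?app x = w}. p (fst x) * q (snd x)) *\<^sub>R word_value w"
      unfolding scaleR_left.sum by (rule sum.cong) auto
    then show "(\<Sum>x\<in>{x \<in> ?A \<times> ?B. ?app x = w}. (p (fst x) * q (snd x)) *\<^sub>R word_value (?app x)) =
        conv p q w *\<^sub>R word_value w"
      by (simp only: inner)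
  qed
  also have "\<dots> = quat_eval (conv p q)"
    by (rule quat_eval_eq_sum[symmetric, OF _ conv_support]) (use fin in simp)
  finally show ?thesis by simp
qed

text \<open>
  A linear section of the evaluation, which writes a quaternion in the words \<open>1, i, j, ij\<close>.
\<close>

definition normal_form :: "quat \<Rightarrow> quat_letter list \<Rightarrow> real" where
  "normal_form q = (\<lambda>w. qre q * word [] w + qi q * word [QI] w + qj q * word [QJ] w + qk q * word [QI, QJ] w)"

lemma normal_form_closed: "q \<in> rational_quats \<Longrightarrow> normal_form q \<in> carrier free_rational"
  unfolding normal_form_def by (intro free_rational_closed) (auto simp: rational_quats_def)

lemma quat_eval_word: "quat_eval (word w) = word_value w"
proof -
  have "{v. word w v \<noteq> 0} = {w}" by (auto simp: word_def)
  then show ?thesis by (simp add: quat_eval_def word_def)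
qed

lemma quat_eval_normal_form: "quat_eval (normal_form q) = q"
proof -
  let ?S = "{[], [QI], [QJ], [QI, QJ]}"
  have "quat_eval (normal_form q) = (\<Sum>w\<in>?S. normal_form q w *\<^sub>R word_value w)"
    by (rule quat_eval_eq_sum) (auto simp: normal_form_def word_def split: if_splits)
  also have "\<dots> = q"
    by (simp add: normal_form_def word_def quat_eq_iff quat_defs)
  finally show ?thesis .
qed

lemma ring_hom_quat_eval: "ring_hom_ring free_rational rational_quaternions quat_eval"
proof (rule ring_hom_ringI[OF ring_free_rational ring_rational_quaternions])
  fix p :: "quat_letter list \<Rightarrow> real" assume p: "p \<in> carrier free_rational"
  have "(\<Sum>w\<in>S. p w *\<^sub>R word_value w) \<in> rational_quats" for S
  proof (induction S rule: infinite_finite_induct)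
    case (insert w S)
    have "p w \<in> \<rat>" using p by (rule free_rational_rational)
    with insert show ?case by (simp add: rational_quats_closed word_value_rational)
  qed (simp_all add: rational_quats_closed)
  then show "quat_eval p \<in> carrier rational_quaternions" by (simp add: quat_eval_def)
qed (simp_all add: free_rational_mult quat_eval_mult free_rational_simps(2-) quat_eval_add quat_eval_word)

lemma quaternion_relations_eq:
  "quaternion_relations rationals (- 1) (- 1) =
    {(\<lambda>w. word [QI, QI] w + word [] w), (\<lambda>w. word [QJ, QJ] w + word [] w),
     (\<lambda>w. word [QJ, QI] w + word [QI, QJ] w)}"
proof -
  have gen: "free_gen rationals l = word [l]" for l :: quat_letter
    by (auto simp: free_gen_def word_def)
  have const: "free_const rationals (- 1) = (\<lambda>w. - word [] w)"
    by (auto simp: free_const_def word_def)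
  have "(\<lambda>w :: quat_letter list. - word [] w) \<in> carrier free_rational"
    using free_rational_closed(3)[OF _ free_rational_closed(1), of "- 1" "[] :: quat_letter list"] by simp
  then show ?thesis
    by (simp add: quaternion_relations_def Let_def gen const free_rational_mult free_rational_minus free_rational_closed
        conv_word_word free_rational_simps(4))
qed

text \<open>
  Modulo any ideal \<open>J\<close> that contains the relations, each element of the free algebra is congruent
  to the normal form of its value. This shows that the relations generate the whole kernel of the
  evaluation.
\<close>

context
  fixes J :: "(quat_letter list \<Rightarrow> real) set"
  assumes ideal: "ideal J free_rational"
    and rels: "quaternion_relations rationals (- 1) (- 1) \<subseteq> J"
begin

interpretation J: ideal J free_rational by (rule ideal)

lemma relation_ideal_carrier: "p \<in> J \<Longrightarrow> p \<in> carrier free_rational"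
  by (rule J.Icarr)

lemma relation_ideal_add: "p \<in> J \<Longrightarrow> q \<in> J \<Longrightarrow> (\<lambda>w. p w + q w) \<in> J"
  using additive_subgroup.a_closed[OF J.is_additive_subgroup] by (simp add: free_rational_simps(4))

lemma relation_ideal_left: "p \<in> carrier free_rational \<Longrightarrow> q \<in> J \<Longrightarrow> conv p q \<in> J"
  using J.I_l_closed[of q p] by (simp add: free_rational_mult relation_ideal_carrier)

lemma relation_ideal_right: "p \<in> carrier free_rational \<Longrightarrow> q \<in> J \<Longrightarrow> conv q p \<in> J"
  using J.I_r_closed[of q p] by (simp add: free_rational_mult relation_ideal_carrier)

lemma relation_ideal_scale: assumes "c \<in> \<rat>" "p \<in> J" shows "(\<lambda>w. c * p w) \<in> J"
proof -
  have "conv (\<lambda>w. c * word [] w) p \<in> J"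
    using assms by (intro relation_ideal_left free_rational_closed)
  moreover have "conv (\<lambda>w. c * word [] w) p = (\<lambda>w. c * p w)"
    by (simp add: fun_eq_iff conv_scale_left conv_Nil_left)
  ultimately show ?thesis by simp
qed

text \<open>
  The difference is a combination of the three relations. Multiplication by \<open>i\<close> uses \<open>ii = -1\<close> and
  \<open>iij = -j\<close>; multiplication by \<open>j\<close> uses \<open>ji = -ij\<close>, \<open>jj = -1\<close> and
  \<open>jij - i = (ji + ij) j - i (jj + 1)\<close>.
\<close>

lemma letter_normal_form:
  assumes "q \<in> rational_quats"
  shows "(\<lambda>w. conv (word [l]) (normal_form q) w - normal_form (letter l * q) w) \<in> J"
proof -
  have q: "qre q \<in> \<rat>" "qi q \<in> \<rat>" "qj q \<in> \<rat>" "qk q \<in> \<rat>"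
    using assms by (simp_all add: rational_quats_def)
  let ?ii = "\<lambda>w. word [QI, QI] w + word [] w" and ?jj = "\<lambda>w. word [QJ, QJ] w + word [] w"
    and ?ji = "\<lambda>w. word [QJ, QI] w + word [QI, QJ] w"
  have r: "?ii \<in> J" "?jj \<in> J" "?ji \<in> J"
    using rels by (simp_all add: quaternion_relations_eq)
  have lnf: "conv (word [l]) (normal_form q) w = qre q * word [l] w + qi q * word [l, QI] w
      + qj q * word [l, QJ] w + qk q * word [l, QI, QJ] w" for w
    by (simp add: normal_form_def conv_add_right conv_scale_right conv_word_word)
  show ?thesis
  proof (cases l)
    case QI
    have "(\<lambda>w. qi q * ?ii w + qk q * conv ?ii (word [QJ]) w) \<in> J"
      by (intro relation_ideal_add relation_ideal_scale relation_ideal_right r q free_rational_closed)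
    also have "(\<lambda>w. qi q * ?ii w + qk q * conv ?ii (word [QJ]) w) =
        (\<lambda>w. conv (word [l]) (normal_form q) w - normal_form (letter l * q) w)"
      unfolding lnf
      by (simp add: QI fun_eq_iff normal_form_def quat_defs conv_add_left conv_word_word algebra_simps)
    finally show ?thesis .
  next
    case QJ
    have "(\<lambda>w. qi q * ?ji w + qj q * ?jj w
        + qk q * (conv ?ji (word [QJ]) w + (- 1) * conv (word [QI]) ?jj w)) \<in> J"
      by (intro relation_ideal_add relation_ideal_scale relation_ideal_right relation_ideal_left r q free_rational_closed) auto
    also have "(\<lambda>w. qi q * ?ji w + qj q * ?jj w
        + qk q * (conv ?ji (word [QJ]) w + (- 1) * conv (word [QI]) ?jj w)) =
        (\<lambda>w. conv (word [l]) (normal_form q) w - normal_form (letter l * q) w)"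
      unfolding lnf
      by (simp add: QJ fun_eq_iff normal_form_def quat_defs conv_add_left conv_add_right
          conv_word_word algebra_simps)
    finally show ?thesis .
  qed
qed

lemma word_normal_form: "(\<lambda>v. word w v - normal_form (word_value w) v) \<in> J"
proof (induction w)
  case Nil
  have "(\<lambda>v. word [] v - normal_form (word_value []) v) = \<zero>\<^bsub>free_rational\<^esub>"
    by (simp add: fun_eq_iff normal_form_def quat_defs free_rational_simps)
  then show ?case by (simp only: additive_subgroup.zero_closed[OF J.is_additive_subgroup])
next
  case (Cons l w)
  let ?n = "normal_form (word_value w)"
  have "(\<lambda>v. conv (word [l]) (\<lambda>v. word w v - ?n v) v
      + (conv (word [l]) ?n v - normal_form (letter l * word_value w) v)) \<in> J"
    by (intro relation_ideal_add relation_ideal_left letter_normal_form word_value_rational free_rational_closed Cons.IH)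
  then show ?case by (simp add: conv_diff_right conv_word_word)
qed

lemma normal_form_congruent:
  assumes p: "p \<in> carrier free_rational"
  shows "(\<lambda>v. p v - normal_form (quat_eval p) v) \<in> J"
proof -
  have "(\<lambda>v. \<Sum>w\<in>S. p w * (word w v - normal_form (word_value w) v)) \<in> J" for S
  proof (induction S rule: infinite_finite_induct)
    case (insert w S)
    have "p w \<in> \<rat>" using p by (rule free_rational_rational)
    then have "(\<lambda>v. p w * (word w v - normal_form (word_value w) v)
        + (\<Sum>w\<in>S. p w * (word w v - normal_form (word_value w) v))) \<in> J"
      by (intro relation_ideal_add relation_ideal_scale word_normal_form insert.IH)
    with insert show ?case by simp
  qed (use additive_subgroup.zero_closed[OF J.is_additive_subgroup] in \<open>simp_all add: free_rational_simps\<close>)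
  then have "(\<lambda>v. \<Sum>w | p w \<noteq> 0. p w * (word w v - normal_form (word_value w) v)) \<in> J" .
  moreover have "(\<Sum>w | p w \<noteq> 0. p w * word w v) = p v" for v
  proof -
    have "finite {w. p w \<noteq> 0}" using p by (simp add: free_rational_simps)
    then show ?thesis by (simp add: word_def if_distrib[of "(*) _"] sum.delta cong: if_cong)
  qed
  moreover have "(\<Sum>w\<in>S. p w * normal_form (word_value w) v) =
      normal_form (\<Sum>w\<in>S. p w *\<^sub>R word_value w) v" for v S
    by (induction S rule: infinite_finite_induct)
      (simp_all add: normal_form_def quat_defs algebra_simps)
  ultimately show ?thesis
    by (simp add: right_diff_distrib sum_subtractf quat_eval_def)
qed

end

lemma kernel_quat_eval:
  "a_kernel free_rational rational_quaternions quat_eval = genideal free_rational (quaternion_relations rationals (- 1) (- 1))"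
    (is "?K = ?J")
proof
  interpret ring free_rational by (rule ring_free_rational)
  interpret h: ring_hom_ring free_rational rational_quaternions quat_eval by (rule ring_hom_quat_eval)
  let ?rels = "quaternion_relations rationals (- 1) (- 1)"
  have rels: "?rels \<subseteq> carrier free_rational"
    by (auto simp: quaternion_relations_eq intro!: free_rational_closed)
  have J: "ideal ?J free_rational" by (rule genideal_ideal[OF rels])
  have sum: "quat_eval (\<lambda>w. word u w + word v w) = word_value u + word_value v" for u v
    using quat_eval_add[OF free_rational_closed(1) free_rational_closed(1)] by (simp add: quat_eval_word)
  have "quat_eval p = 0" if "p \<in> ?rels" for p
  proof -
    obtain u v where p: "p = (\<lambda>w. word u w + word v w)"
      and uv: "(u, v) \<in> {([QI, QI], []), ([QJ, QJ], []), ([QJ, QI], [QI, QJ])}"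
      using \<open>p \<in> ?rels\<close> unfolding quaternion_relations_eq by blast
    show ?thesis
      unfolding p sum using uv by (auto simp: quat_defs)
  qed
  with rels have "?rels \<subseteq> ?K"
    unfolding a_kernel_def' type_subring_simps by blast
  then show "?J \<subseteq> ?K" by (rule genideal_minimal[OF h.kernel_is_ideal])
  show "?K \<subseteq> ?J"
  proof
    fix p assume "p \<in> ?K"
    then have p: "p \<in> carrier free_rational" "quat_eval p = 0"
      unfolding a_kernel_def' type_subring_simps by blast+
    have "(\<lambda>v. p v - normal_form (quat_eval p) v) \<in> ?J"
      using normal_form_congruent[OF J genideal_self[OF rels] p(1)] .
    then show "p \<in> ?J" by (simp add: p(2) normal_form_def quat_defs)
  qed
qed

lemma quaternion_algebra_iso:
  "\<exists>h. h \<in> ring_iso (quaternion_algebra rationals (- 1) (- 1)) rational_quaternions"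
proof -
  interpret h: ring_hom_ring free_rational rational_quaternions quat_eval by (rule ring_hom_quat_eval)
  have "quat_eval ` carrier free_rational = carrier rational_quaternions"
  proof
    show "quat_eval ` carrier free_rational \<subseteq> carrier rational_quaternions" using h.hom_closed by blast
    show "carrier rational_quaternions \<subseteq> quat_eval ` carrier free_rational"
      using normal_form_closed quat_eval_normal_form by (metis image_eqI subsetI type_subring_simps(1))
  qed
  from h.FactRing_iso_set[OF this] show ?thesis
    unfolding kernel_quat_eval quaternion_algebra_def by blast
qed

section \<open>A left ideal with zeros but no commuting zeros\<close>

lemma division_ring_ring_iso:
  assumes Q: "ring Q" and h: "h \<in> ring_iso Q H" and H: "division_ring H"
  shows "division_ring Q"
proof -
  interpret Q: ring Q by (rule Q)
  interpret H: ring H using H by (simp add: division_ring_def)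
  have hom: "h \<in> ring_hom Q H" and bij: "bij_betw h (carrier Q) (carrier H)"
    using h by (auto simp: ring_iso_def)
  note h_simps = ring_hom_closed[OF hom] ring_hom_mult[OF hom] ring_hom_one[OF hom]
    ring_hom_zero[OF hom Q H.ring_axioms]
  have inj: "h x = h y \<longleftrightarrow> x = y" if "x \<in> carrier Q" "y \<in> carrier Q" for x y
    using bij that by (auto simp: bij_betw_def inj_on_def)
  have one: "\<one>\<^bsub>Q\<^esub> \<noteq> \<zero>\<^bsub>Q\<^esub>"
    using H h_simps by (metis division_ring_def)
  have "x \<in> Units Q" if "x \<in> carrier Q" "x \<noteq> \<zero>\<^bsub>Q\<^esub>" for x
  proof -
    have "h x \<in> Units H"
      using H that h_simps inj[of x "\<zero>\<^bsub>Q\<^esub>"] by (auto simp: division_ring_def)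
    then obtain y' where y': "y' \<in> carrier H" "y' \<otimes>\<^bsub>H\<^esub> h x = \<one>\<^bsub>H\<^esub>" "h x \<otimes>\<^bsub>H\<^esub> y' = \<one>\<^bsub>H\<^esub>"
      by (auto simp: Units_def)
    then obtain y where y: "y \<in> carrier Q" "y' = h y"
      using bij by (auto simp: bij_betw_def)
    have "y \<otimes>\<^bsub>Q\<^esub> x = \<one>\<^bsub>Q\<^esub>" "x \<otimes>\<^bsub>Q\<^esub> y = \<one>\<^bsub>Q\<^esub>"
      using y y' that inj[of "y \<otimes>\<^bsub>Q\<^esub> x" "\<one>\<^bsub>Q\<^esub>"] inj[of "x \<otimes>\<^bsub>Q\<^esub> y" "\<one>\<^bsub>Q\<^esub>"]
      by (simp_all add: h_simps)
    with that y show ?thesis by (auto simp: Units_def)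
  qed
  moreover have "\<zero>\<^bsub>Q\<^esub> \<notin> Units Q"
    using one by (auto simp: Units_def)
  ultimately show ?thesis
    using Q one by (auto simp: division_ring_def)
qed

theorem mainTheorem3:
  shows "\<exists>(F :: real ring) Q I.
           field F \<and> \<one>\<^bsub>F\<^esub> \<oplus>\<^bsub>F\<^esub> \<one>\<^bsub>F\<^esub> \<noteq> \<zero>\<^bsub>F\<^esub>
         \<and> quaternion_division_algebra F Q
         \<and> left_ideal I (poly2 Q)
         \<and> commuting_zero_locus Q I = {}
         \<and> zero_locus Q I \<noteq> {}
         \<and> (\<exists>f\<in>carrier (poly2 Q).
               vanishes_on Q f (commuting_zero_locus Q I)
             \<and> \<not> vanishes_on Q f (zero_locus Q I))"
proof -
  define Q where "Q = quaternion_algebra rationals (- 1) (- 1)"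
  obtain h where h: "h \<in> ring_iso Q rational_quaternions"
    unfolding Q_def using quaternion_algebra_iso by blast
  have ringQ: "ring Q"
  proof -
    interpret ring "free_rational" by (rule ring_free_rational)
    have "quaternion_relations rationals (- 1) (- 1) \<subseteq> carrier free_rational"
      by (auto simp: quaternion_relations_eq intro!: free_rational_closed)
    then show ?thesis
      unfolding Q_def quaternion_algebra_def
      by (intro ideal.quotient_is_ring genideal_ideal)
  qed
  have divQ: "division_ring Q"
    using division_ring_ring_iso[OF ringQ h division_ring_rational_quaternions] .
  interpret Q: ring Q by (rule ringQ)
  have hom: "h \<in> ring_hom Q rational_quaternions" and bij: "bij_betw h (carrier Q) rational_quats"
    using h by (auto simp: ring_iso_def)
  have h_simps: "h (a \<otimes>\<^bsub>Q\<^esub> b) = h a * h b" "h (a \<oplus>\<^bsub>Q\<^esub> b) = h a + h b"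
    if "a \<in> carrier Q" "b \<in> carrier Q" for a b
    using ring_hom_mult[OF hom that] ring_hom_add[OF hom that] by simp_all
  have h_const: "h \<one>\<^bsub>Q\<^esub> = 1" "h \<zero>\<^bsub>Q\<^esub> = 0"
    using ring_hom_one[OF hom] ring_hom_zero[OF hom ringQ ring_rational_quaternions] by simp_all
  have h_mem: "h a \<in> rational_quats" if "a \<in> carrier Q" for a
    using bij that by (auto simp: bij_betw_def)
  have h_inj: "a = b" if "a \<in> carrier Q" "b \<in> carrier Q" "h a = h b" for a b
    using bij that by (auto simp: bij_betw_def inj_on_def)

  define I where "I = Q.quadratic_ideal \<one>\<^bsub>Q\<^esub> (\<one>\<^bsub>Q\<^esub> \<oplus>\<^bsub>Q\<^esub> \<one>\<^bsub>Q\<^esub>)"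
  have I: "left_ideal I (poly2 Q)"
    unfolding I_def by (rule Q.left_ideal_quadratic_ideal) simp_all
  have locus: "zero_locus Q I = {(a, b). a \<in> carrier Q \<and> b \<in> carrier Q
      \<and> a \<otimes>\<^bsub>Q\<^esub> a \<oplus>\<^bsub>Q\<^esub> \<one>\<^bsub>Q\<^esub> = \<zero>\<^bsub>Q\<^esub> \<and> b \<otimes>\<^bsub>Q\<^esub> b \<oplus>\<^bsub>Q\<^esub> (\<one>\<^bsub>Q\<^esub> \<oplus>\<^bsub>Q\<^esub> \<one>\<^bsub>Q\<^esub>) = \<zero>\<^bsub>Q\<^esub>}"
    unfolding I_def by (rule Q.zero_locus_quadratic_ideal) (simp_all add: Q.l_distr Q.r_distr)

  have nonempty: "zero_locus Q I \<noteq> {}"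
  proof -
    have surj: "\<exists>a\<in>carrier Q. h a = q" if "q \<in> rational_quats" for q
    proof -
      from that have "q \<in> h ` carrier Q" by (simp only: bij_betw_imp_surj_on[OF bij])
      then show ?thesis by blast
    qed
    \<comment> \<open>The pair \<open>(i, i + j)\<close>; the square of \<open>i + j\<close> is \<open>i\<^sup>2 + j\<^sup>2 = -2\<close> because \<open>ij + ji = 0\<close>.\<close>
    obtain a where a: "a \<in> carrier Q" "h a = Quat 0 1 0 0"
      using surj[of "Quat 0 1 0 0"] by (auto simp: rational_quats_def)
    obtain b where b: "b \<in> carrier Q" "h b = Quat 0 1 1 0"
      using surj[of "Quat 0 1 1 0"] by (auto simp: rational_quats_def)
    note ab = a b
    have "a \<otimes>\<^bsub>Q\<^esub> a \<oplus>\<^bsub>Q\<^esub> \<one>\<^bsub>Q\<^esub> = \<zero>\<^bsub>Q\<^esub>"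
      by (rule h_inj) (use ab in \<open>simp_all add: h_simps h_const quat_defs\<close>)
    moreover have "b \<otimes>\<^bsub>Q\<^esub> b \<oplus>\<^bsub>Q\<^esub> (\<one>\<^bsub>Q\<^esub> \<oplus>\<^bsub>Q\<^esub> \<one>\<^bsub>Q\<^esub>) = \<zero>\<^bsub>Q\<^esub>"
      by (rule h_inj) (use ab in \<open>simp_all add: h_simps h_const quat_defs\<close>)
    ultimately show ?thesis using ab by (auto simp: locus)
  qed

  have empty: "commuting_zero_locus Q I = {}"
  proof -
    have False if "(a, b) \<in> commuting_zero_locus Q I" for a b
    proof -
      have ab: "a \<in> carrier Q" "b \<in> carrier Q"
        and "h (a \<otimes>\<^bsub>Q\<^esub> a \<oplus>\<^bsub>Q\<^esub> \<one>\<^bsub>Q\<^esub>) = h \<zero>\<^bsub>Q\<^esub>"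
        and "h (b \<otimes>\<^bsub>Q\<^esub> b \<oplus>\<^bsub>Q\<^esub> (\<one>\<^bsub>Q\<^esub> \<oplus>\<^bsub>Q\<^esub> \<one>\<^bsub>Q\<^esub>)) = h \<zero>\<^bsub>Q\<^esub>"
        and "h (a \<otimes>\<^bsub>Q\<^esub> b) = h (b \<otimes>\<^bsub>Q\<^esub> a)"
        using that by (auto simp: commuting_zero_locus_def commuting_pairs_def locus)
      then have "h a * h a + 1 = 0" "h b * h b + (1 + 1) = 0" "h a * h b = h b * h a"
        by (simp_all add: h_simps h_const)
      then have "h a * h a = - 1" "h b * h b = - 2" "h a * h b = h b * h a"
        by (simp_all add: add_eq_0_iff2)
      then show False using no_commuting_roots h_mem ab by blast
    qed
    then show ?thesis by auto
  qed

  have "\<not> vanishes_on Q (Q.monom2 \<one>\<^bsub>Q\<^esub> 0 0) (zero_locus Q I)"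
  proof
    assume "vanishes_on Q (Q.monom2 \<one>\<^bsub>Q\<^esub> 0 0) (zero_locus Q I)"
    moreover obtain a b where "(a, b) \<in> zero_locus Q I" using nonempty by fast
    ultimately have "eval2 Q (Q.monom2 \<one>\<^bsub>Q\<^esub> 0 0) a b = \<zero>\<^bsub>Q\<^esub>" "a \<in> carrier Q" "b \<in> carrier Q"
      by (auto simp: vanishes_on_def zero_locus_def)
    then have "\<one>\<^bsub>Q\<^esub> = \<zero>\<^bsub>Q\<^esub>" by (simp add: Q.eval2_monom2)
    with divQ show False by (simp add: division_ring_def)
  qed
  moreover have "vanishes_on Q (Q.monom2 \<one>\<^bsub>Q\<^esub> 0 0) (commuting_zero_locus Q I)"
    by (simp add: empty vanishes_on_def)
  ultimately have "\<exists>f\<in>carrier (poly2 Q). vanishes_on Q f (commuting_zero_locus Q I)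
      \<and> \<not> vanishes_on Q f (zero_locus Q I)"
    using Q.monom2_closed[OF Q.one_closed] by blast
  moreover have "quaternion_division_algebra rationals Q"
    using divQ unfolding quaternion_division_algebra_def Q_def
    by (intro conjI bexI[of _ "- 1"]) auto
  moreover have "\<one>\<^bsub>rationals\<^esub> \<oplus>\<^bsub>rationals\<^esub> \<one>\<^bsub>rationals\<^esub> \<noteq> \<zero>\<^bsub>rationals\<^esub>"
    by simp
  ultimately show ?thesis
    using field_rationals I nonempty empty by blast
qed

end
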